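(* Let $K$ be a finite abstract simplicial complex and let $\mathrm{sd}\, K$ be its first barycentric subdivision. Then $\mathrm{scat}(\mathrm{sd}\, K)\leq \mathrm{scat}\, K$.
   Context: Two simplicial maps $\varphi,\psi\colon K\to L$ between abstract simplicial complexes are contiguous, $\varphi\sim_c\psi$, if for every simplex $\sigma$ of $K$ the set of vertices $\varphi(\sigma)\cup\psi(\sigma)$ is a simplex of $L$. They are in the same contiguity class, $\varphi\sim\psi$, if there is a finite sequence of simplicial maps $\varphi=\varphi_1\sim_c\varphi_2\sim_c\cdots\sim_c\varphi_m=\psi$ from $K$ to $L$. A subcomplex $U\subset K$ is categorical (in $K$) if there is a vertex $v\in K$ such that the inclusion $U\to K$ and the constant map $c_v\colon U\to K$ with value $v$ are in the same contiguity class. The simplicial LS-category $\mathrm{scat}\, K$ is the least integer $n\geq 0$ such that $K=U_0\cup\cdots\cup U_n$ for some $n+1$ categorical subcomplexes $U_0,\dots,U_n$ of $K$. Complexes are assumed nonempty. The first barycentric subdivision $\mathrm{sd}\,K$ is the abstract simplicial complex whose vertices are the (nonempty) simplices of $K$, and whose simplices are the sets $\{\sigma_1,\dots,\sigma_q\}$ of simplices of $K$ with $\sigma_1\subset\cdots\subset\sigma_q$. *)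

theory Defs
  imports "HOL-Library.Extended_Nat"
begin

(* A complex is given by its set of (nonempty, finite) simplices. *)
definition abstract_simplicial_complex :: "'a set set \<Rightarrow> bool" where
  "abstract_simplicial_complex K \<longleftrightarrow>
     K \<noteq> {} \<and>
     (\<forall>\<sigma>\<in>K. finite \<sigma> \<and> \<sigma> \<noteq> {}) \<and>
     (\<forall>\<sigma>\<in>K. \<forall>\<tau>. \<tau> \<noteq> {} \<and> \<tau> \<subseteq> \<sigma> \<longrightarrow> \<tau> \<in> K)"

definition vertices :: "'a set set \<Rightarrow> 'a set" where
  "vertices K = \<Union>K"

definition subcomplex :: "'a set set \<Rightarrow> 'a set set \<Rightarrow> bool" where
  "subcomplex U K \<longleftrightarrow> abstract_simplicial_complex U \<and> U \<subseteq> K"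

(* Simplicial maps are represented by total functions on the vertex type; their values
   off the vertices of K play no role, since two simplicial maps that agree on the
   vertices of K are contiguous. *)
definition simplicial_map :: "'a set set \<Rightarrow> 'b set set \<Rightarrow> ('a \<Rightarrow> 'b) \<Rightarrow> bool" where
  "simplicial_map K L \<phi> \<longleftrightarrow> (\<forall>\<sigma>\<in>K. \<phi> ` \<sigma> \<in> L)"

definition contiguous :: "'a set set \<Rightarrow> 'b set set \<Rightarrow> ('a \<Rightarrow> 'b) \<Rightarrow> ('a \<Rightarrow> 'b) \<Rightarrow> bool" where
  "contiguous K L \<phi> \<psi> \<longleftrightarrow>
     simplicial_map K L \<phi> \<and> simplicial_map K L \<psi> \<and>
     (\<forall>\<sigma>\<in>K. \<phi> ` \<sigma> \<union> \<psi> ` \<sigma> \<in> L)"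

definition same_contiguity_class ::
    "'a set set \<Rightarrow> 'b set set \<Rightarrow> ('a \<Rightarrow> 'b) \<Rightarrow> ('a \<Rightarrow> 'b) \<Rightarrow> bool" where
  "same_contiguity_class K L \<phi> \<psi> \<longleftrightarrow>
     simplicial_map K L \<phi> \<and> simplicial_map K L \<psi> \<and> (contiguous K L)\<^sup>*\<^sup>* \<phi> \<psi>"

definition categorical :: "'a set set \<Rightarrow> 'a set set \<Rightarrow> bool" where
  "categorical K U \<longleftrightarrow>
     subcomplex U K \<and> (\<exists>v\<in>vertices K. same_contiguity_class U K (\<lambda>x. x) (\<lambda>_. v))"

(* The value is infinite exactly when no finite categorical cover exists, which cannot
   happen for a finite complex: every closed simplex is a categorical subcomplex. *)
definition scat :: "'a set set \<Rightarrow> enat" where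
  "scat K = Inf {enat n | n.
     \<exists>U :: nat \<Rightarrow> 'a set set. (\<forall>i\<le>n. categorical K (U i)) \<and> K = (\<Union>i\<le>n. U i)}"

definition sd :: "'a set set \<Rightarrow> 'a set set set" where
  "sd K = {set \<sigma>s | \<sigma>s. \<sigma>s \<noteq> [] \<and> set \<sigma>s \<subseteq> K \<and> sorted_wrt (\<subset>) \<sigma>s}"

lemma sd_memI:
  assumes "\<sigma>s \<noteq> []" "set \<sigma>s \<subseteq> K" "sorted_wrt (\<subset>) \<sigma>s"
  shows "set \<sigma>s \<in> sd K"
  unfolding sd_def using assms by blast

lemma singleton_in_sd: "\<sigma> \<in> K \<Longrightarrow> {\<sigma>} \<in> sd K"
  using sd_memI[of "[\<sigma>]" K] by simp

lemma abstract_simplicial_complex_sd: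
  assumes "abstract_simplicial_complex K"
  shows "abstract_simplicial_complex (sd K)"
  unfolding abstract_simplicial_complex_def
proof (intro conjI ballI allI impI)
  from assms obtain \<sigma> where "\<sigma> \<in> K"
    unfolding abstract_simplicial_complex_def by blast
  then show "sd K \<noteq> {}"
    using singleton_in_sd by blast
next
  fix C assume "C \<in> sd K"
  then obtain \<sigma>s where "C = set \<sigma>s" "\<sigma>s \<noteq> []"
    unfolding sd_def by blast
  then show "finite C" and "C \<noteq> {}"
    by simp_all
next
  fix C D assume "C \<in> sd K" and D: "D \<noteq> {} \<and> D \<subseteq> C"
  then obtain \<sigma>s where \<sigma>s: "C = set \<sigma>s" "set \<sigma>s \<subseteq> K" "sorted_wrt (\<subset>) \<sigma>s"
    unfolding sd_def by blast
  define \<tau>s where "\<tau>s = filter (\<lambda>\<sigma>. \<sigma> \<in> D) \<sigma>s"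
  have set_eq: "set \<tau>s = D" using D \<sigma>s(1) unfolding \<tau>s_def set_filter by blast
  have "sorted_wrt (\<subset>) \<tau>s"
    unfolding \<tau>s_def using \<sigma>s(3) by (rule sorted_wrt_filter)
  moreover have "\<tau>s \<noteq> []" using D set_eq by (metis empty_set)
  moreover have "set \<tau>s \<subseteq> K" using D set_eq \<sigma>s by blast
  ultimately show "D \<in> sd K"
    using sd_memI[of \<tau>s K] set_eq by metis
qed

lemma vertices_sd: "vertices (sd K) = K"
proof
  show "vertices (sd K) \<subseteq> K"
    unfolding vertices_def sd_def by blast
  show "K \<subseteq> vertices (sd K)"
    unfolding vertices_def using singleton_in_sd by blast
qed

end

(* Taking images turns a simplicial map f into sd f, which is an order-preserving map between
   face posets.  If f and g are contiguous, then s \<mapsto> f s \<union> g s is an order-preserving map above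
   both sd f and sd g, so it suffices to treat order-preserving maps F \<le> G.  These are joined by
   the maps that take the value of G on simplices with at least n vertices and the value of F on
   the others: a chain contains at most one simplex with exactly n vertices, so replacing n by
   n + 1 gives a contiguous map.  Hence sd U is categorical in sd K if U is categorical in K. *)
theory Submission
  imports Defs
begin

section \<open>Simplices of the subdivision as finite chains\<close>

lemma chain_subset_set_if_sorted_wrt:
  "sorted_wrt (\<subset>) \<sigma>s \<Longrightarrow> chain_subset (set \<sigma>s)"
  by (induction \<sigma>s) (auto simp: chain_subset_def)

text \<open>A maximal element of a chain strictly contains all the others, so it can be removed and
  appended behind a sorted list of the rest.\<close>

lemma finite_chain_subset_sorted_wrt:
  assumes "finite C" "chain_subset C"
  shows "\<exists>\<sigma>s. set \<sigma>s = C \<and> sorted_wrt (\<subset>) \<sigma>s"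
  using assms
proof (induction C rule: finite_psubset_induct)
  case (psubset C)
  show ?case
  proof (cases "C = {}")
    case True
    then show ?thesis by (intro exI[of _ "[]"]) simp
  next
    case False
    then obtain M where M: "M \<in> C" "\<And>\<sigma>. \<sigma> \<in> C \<Longrightarrow> M \<subseteq> \<sigma> \<Longrightarrow> M = \<sigma>"
      using finite_has_maximal[OF psubset.hyps] by blast
    have below: "\<sigma> \<subset> M" if "\<sigma> \<in> C - {M}" for \<sigma>
      using that M psubset.prems unfolding chain_subset_def by blast
    have "chain_subset (C - {M})"
      using psubset.prems unfolding chain_subset_def by blast
    with psubset.IH[of "C - {M}"] M(1)
    obtain \<sigma>s where \<sigma>s: "set \<sigma>s = C - {M}" "sorted_wrt (\<subset>) \<sigma>s" by blast
    then have "sorted_wrt (\<subset>) (\<sigma>s @ [M])"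
      using below by (simp add: sorted_wrt_append)
    moreover have "set (\<sigma>s @ [M]) = C" using \<sigma>s(1) M(1) by auto
    ultimately show ?thesis by blast
  qed
qed

text \<open>Trades the sorted lists in the definition of \<open>sd\<close> for a condition on sets,
  which is easier to check for images and unions.\<close>

lemma mem_sd_iff:
  "C \<in> sd K \<longleftrightarrow> finite C \<and> C \<noteq> {} \<and> C \<subseteq> K \<and> chain_subset C"
proof
  assume "C \<in> sd K"
  then show "finite C \<and> C \<noteq> {} \<and> C \<subseteq> K \<and> chain_subset C"
    unfolding sd_def using chain_subset_set_if_sorted_wrt by auto
next
  assume C: "finite C \<and> C \<noteq> {} \<and> C \<subseteq> K \<and> chain_subset C"
  then obtain \<sigma>s where "set \<sigma>s = C" "sorted_wrt (\<subset>) \<sigma>s"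
    using finite_chain_subset_sorted_wrt by blast
  with C show "C \<in> sd K"
    using sd_memI[of \<sigma>s K] by auto
qed

section \<open>Contiguity and contiguity classes\<close>

lemma contiguous_sym: "contiguous K L f g \<Longrightarrow> contiguous K L g f"
  unfolding contiguous_def by (simp add: Un_commute)

lemma contiguous_rtranclp_sym:
  "(contiguous K L)\<^sup>*\<^sup>* f g \<Longrightarrow> (contiguous K L)\<^sup>*\<^sup>* g f"
  by (metis contiguous_sym sympD sympI symp_rtranclp)

text \<open>Simplicial maps are total functions, and constructions control them only on vertices.
  One contiguity step absorbs any disagreement elsewhere.\<close>

lemma contiguous_if_eq_on_vertices:
  assumes "simplicial_map K L f" "\<And>x. x \<in> vertices K \<Longrightarrow> f x = g x"
  shows "contiguous K L f g"
proof -
  have "f ` \<sigma> = g ` \<sigma>" if "\<sigma> \<in> K" for \<sigma>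
    using that assms(2) by (intro image_cong) (auto simp: vertices_def)
  with assms(1) show ?thesis
    unfolding contiguous_def simplicial_map_def by auto
qed

text \<open>A path may have length zero and then says nothing about its ends, hence the assumption
  on \<open>f\<close>.\<close>

lemma simplicial_map_if_contiguous_rtranclp:
  "(contiguous K L)\<^sup>*\<^sup>* f g \<Longrightarrow> simplicial_map K L f \<Longrightarrow> simplicial_map K L g"
  by (induction rule: rtranclp_induct) (auto simp: contiguous_def)

text \<open>Monotone maps preserve comparability, so they send chains to chains. Collapsing is
  harmless because a simplex of \<open>sd\<close> is only the set of members of a chain.\<close>

lemma simplicial_map_sd_if_mono_on:
  assumes "mono_on U f" "f ` U \<subseteq> K"
  shows "simplicial_map (sd U) (sd K) f"
  unfolding simplicial_map_def
proof
  fix C assume "C \<in> sd U"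
  then have C: "finite C" "C \<noteq> {}" "C \<subseteq> U" "chain_subset C"
    by (simp_all add: mem_sd_iff)
  have "f \<sigma> \<subseteq> f \<tau> \<or> f \<tau> \<subseteq> f \<sigma>" if "\<sigma> \<in> C" "\<tau> \<in> C" for \<sigma> \<tau>
  proof -
    have "\<sigma> \<in> U" "\<tau> \<in> U" using that C(3) by auto
    then have "\<sigma> \<subseteq> \<tau> \<Longrightarrow> f \<sigma> \<subseteq> f \<tau>" "\<tau> \<subseteq> \<sigma> \<Longrightarrow> f \<tau> \<subseteq> f \<sigma>"
      using mono_onD[OF assms(1)] by simp_all
    moreover have "\<sigma> \<subseteq> \<tau> \<or> \<tau> \<subseteq> \<sigma>"
      using that C(4) by (simp add: chain_subset_def)
    ultimately show ?thesis by blast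
  qed
  then have "chain_subset (f ` C)"
    by (simp add: chain_subset_def)
  with C assms(2) show "f ` C \<in> sd K"
    by (auto simp: mem_sd_iff)
qed

lemma contiguous_rtranclp_sd_if_le:
  fixes f g :: "'a set \<Rightarrow> 'b set"
  assumes U: "finite U" "\<And>\<sigma>. \<sigma> \<in> U \<Longrightarrow> finite \<sigma>"
    and f: "mono_on U f" "f ` U \<subseteq> K"
    and g: "mono_on U g" "g ` U \<subseteq> K"
    and le: "\<And>\<sigma>. \<sigma> \<in> U \<Longrightarrow> f \<sigma> \<subseteq> g \<sigma>"
  shows "(contiguous (sd U) (sd K))\<^sup>*\<^sup>* f g"
proof -
  define h where "h n \<sigma> = (if n \<le> card \<sigma> then g \<sigma> else f \<sigma>)" for n \<sigma>
  \<comment> \<open>The only bad case is \<open>g \<sigma>\<close> against \<open>f \<tau>\<close>.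
    It requires \<open>m \<le> card \<sigma> < card \<tau> < n\<close>, hence
    \<open>m + 2 \<le> n\<close>, which neighbouring thresholds exclude.\<close>
  have comparable: "h m \<sigma> \<subseteq> h n \<tau>"
    if "\<sigma> \<in> U" "\<tau> \<in> U" "\<sigma> \<subset> \<tau>" "m = n \<or> m = Suc n \<or> n = Suc m" for m n \<sigma> \<tau>
  proof -
    have "card \<sigma> < card \<tau>"
      using U(2)[OF that(2)] that(3) by (rule psubset_card_mono)
    moreover have mono: "f \<sigma> \<subseteq> f \<tau>" "g \<sigma> \<subseteq> g \<tau>"
      using that by (auto intro: mono_onD[OF f(1), THEN subsetD] mono_onD[OF g(1), THEN subsetD])
    moreover have "f \<sigma> \<subseteq> g \<tau>"
      using le[OF that(1)] mono(2) by (rule subset_trans)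
    ultimately show ?thesis
      using that(4) unfolding h_def by auto
  qed
  have mono: "mono_on U (h n)" for n
  proof (rule mono_onI)
    fix \<sigma> \<tau> assume "\<sigma> \<in> U" "\<tau> \<in> U" "\<sigma> \<subseteq> \<tau>"
    then show "h n \<sigma> \<subseteq> h n \<tau>"
      using comparable[of \<sigma> \<tau> n n] by (cases "\<sigma> = \<tau>") auto
  qed
  have range: "h n ` U \<subseteq> K" for n
    using f(2) g(2) unfolding h_def by auto
  have step: "contiguous (sd U) (sd K) (h (Suc n)) (h n)" for n
    unfolding contiguous_def
  proof (intro conjI ballI simplicial_map_sd_if_mono_on mono range)
    fix C assume "C \<in> sd U"
    then have C: "finite C" "C \<noteq> {}" "C \<subseteq> U" "chain_subset C"
      by (simp_all add: mem_sd_iff)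
    \<comment> \<open>The case \<open>i = j\<close> handles pairs within one image, the other two
      cases handle pairs across the two images.\<close>
    have "h i \<sigma> \<subseteq> h j \<tau> \<or> h j \<tau> \<subseteq> h i \<sigma>"
      if ij: "i = j \<or> i = Suc j \<or> j = Suc i" and in_C: "\<sigma> \<in> C" "\<tau> \<in> C" for i j \<sigma> \<tau>
    proof -
      have U: "\<sigma> \<in> U" "\<tau> \<in> U" using in_C C(3) by auto
      have "\<sigma> \<subseteq> \<tau> \<or> \<tau> \<subseteq> \<sigma>" using in_C C(4) by (simp add: chain_subset_def)
      then consider "\<sigma> = \<tau>" | "\<sigma> \<subset> \<tau>" | "\<tau> \<subset> \<sigma>" by blast
      then show ?thesis
      proof cases
        case 1
        with le[OF U(1)] show ?thesis unfolding h_def by simp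
      next
        case 2
        then show ?thesis using comparable[OF U] ij by blast
      next
        case 3
        then show ?thesis using comparable[OF U(2,1)] ij by blast
      qed
    qed
    then have "chain_subset (h (Suc n) ` C \<union> h n ` C)"
      by (simp add: chain_subset_def ball_Un)
    moreover have "h (Suc n) ` C \<union> h n ` C \<subseteq> K"
      using C(3) range by blast
    ultimately show "h (Suc n) ` C \<union> h n ` C \<in> sd K"
      using C by (simp add: mem_sd_iff)
  qed
  have "(contiguous (sd U) (sd K))\<^sup>*\<^sup>* (h n) g" for n
  proof (induction n)
    case 0
    \<comment> \<open>The threshold 0 is always met, so this is an equality of total
      functions.\<close>
    have "h 0 = g" unfolding h_def by auto
    then show ?case by simp
  next
    case (Suc n)
    with step show ?case by (rule converse_rtranclp_into_rtranclp)
  qed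
  \<comment> \<open>As \<open>U\<close> is finite, cardinalities are bounded and the threshold
    \<open>N\<close> is never met on \<open>U\<close>. Elsewhere \<open>h N\<close> and
    \<open>f\<close> may differ, so they are joined by a contiguity step.\<close>
  moreover obtain N where N: "\<And>\<sigma>. \<sigma> \<in> U \<Longrightarrow> card \<sigma> < N"
    using finite_nat_set_iff_bounded[of "card ` U"] U(1) by auto
  have "contiguous (sd U) (sd K) f (h N)"
  proof (rule contiguous_if_eq_on_vertices)
    show "simplicial_map (sd U) (sd K) f"
      using f by (rule simplicial_map_sd_if_mono_on)
    show "f \<sigma> = h N \<sigma>" if "\<sigma> \<in> vertices (sd U)" for \<sigma>
      using N[of \<sigma>] that unfolding h_def vertices_sd by simp
  qed
  ultimately show ?thesis
    by (meson converse_rtranclp_into_rtranclp)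
qed

lemma contiguous_sd:
  assumes U: "finite U" "\<And>\<sigma>. \<sigma> \<in> U \<Longrightarrow> finite \<sigma>"
    and "contiguous U K f g"
  shows "(contiguous (sd U) (sd K))\<^sup>*\<^sup>* ((`) f) ((`) g)"
proof -
  have K: "f ` \<sigma> \<in> K" "g ` \<sigma> \<in> K" "f ` \<sigma> \<union> g ` \<sigma> \<in> K" if "\<sigma> \<in> U" for \<sigma>
    using assms(3) that unfolding contiguous_def simplicial_map_def by auto
  \<comment> \<open>Contiguity of \<open>f\<close> and \<open>g\<close> is what puts the values of
    \<open>?F\<close> in \<open>K\<close>. The path climbs from \<open>f\<close> to
    \<open>?F\<close> and then descends to \<open>g\<close>, by symmetry.\<close>
  let ?F = "\<lambda>\<sigma>. f ` \<sigma> \<union> g ` \<sigma>"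
  have mono: "mono_on U ((`) f)" "mono_on U ((`) g)" "mono_on U ?F"
    by (auto intro!: mono_onI)
  have "(contiguous (sd U) (sd K))\<^sup>*\<^sup>* ((`) f) ?F"
    using U mono K by (intro contiguous_rtranclp_sd_if_le) auto
  moreover have "(contiguous (sd U) (sd K))\<^sup>*\<^sup>* ((`) g) ?F"
    using U mono K by (intro contiguous_rtranclp_sd_if_le) auto
  ultimately show ?thesis
    using contiguous_rtranclp_sym by (meson rtranclp_trans)
qed

lemma contiguous_rtranclp_sd:
  assumes "finite U" "\<And>\<sigma>. \<sigma> \<in> U \<Longrightarrow> finite \<sigma>" "(contiguous U K)\<^sup>*\<^sup>* f g"
  shows "(contiguous (sd U) (sd K))\<^sup>*\<^sup>* ((`) f) ((`) g)"
  using assms(3)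
proof (induction rule: rtranclp_induct)
  case (step g h)
  then show ?case
    using contiguous_sd[OF assms(1,2)] by (meson rtranclp_trans)
qed simp

lemma sd_mono: "U \<subseteq> K \<Longrightarrow> sd U \<subseteq> sd K"
  unfolding sd_def by blast

lemma categorical_sd:
  assumes "finite U" "categorical K U"
  shows "categorical (sd K) (sd U)"
proof -
  from assms(2) obtain v where U: "abstract_simplicial_complex U" "U \<subseteq> K"
    and v: "simplicial_map U K (\<lambda>_. v)" "(contiguous U K)\<^sup>*\<^sup>* (\<lambda>x. x) (\<lambda>_. v)"
    unfolding categorical_def subcomplex_def same_contiguity_class_def by blast
  have simplex: "finite \<sigma>" "\<sigma> \<noteq> {}" if "\<sigma> \<in> U" for \<sigma>
    using U(1) that unfolding abstract_simplicial_complex_def by auto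
  from U(1) obtain \<sigma> where "\<sigma> \<in> U"
    unfolding abstract_simplicial_complex_def by blast
  \<comment> \<open>The constant map on \<open>sd U\<close> will take the value \<open>{v}\<close>.
    This is a vertex of \<open>sd K\<close>, being the image of any simplex of \<open>U\<close>
    under the constant map \<open>v\<close>.\<close>
  with v(1) have "(\<lambda>_. v) ` \<sigma> \<in> K"
    unfolding simplicial_map_def by blast
  moreover have "(\<lambda>_. v) ` \<sigma> = {v}"
    using simplex(2)[OF \<open>\<sigma> \<in> U\<close>] by auto
  ultimately have vK: "{v} \<in> K" by simp
  have id: "simplicial_map (sd U) (sd K) (\<lambda>\<sigma>. \<sigma>)"
    unfolding simplicial_map_def using sd_mono[OF U(2)] by auto
  have "(contiguous (sd U) (sd K))\<^sup>*\<^sup>* ((`) (\<lambda>x. x)) ((`) (\<lambda>_. v))"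
    using assms(1) simplex(1) v(2) by (rule contiguous_rtranclp_sd)
  then have path: "(contiguous (sd U) (sd K))\<^sup>*\<^sup>* (\<lambda>\<sigma>. \<sigma>) ((`) (\<lambda>_. v))"
    unfolding image_ident .
  \<comment> \<open>The two maps still differ off the vertices, at the empty set.\<close>
  have "contiguous (sd U) (sd K) ((`) (\<lambda>_. v)) (\<lambda>_. {v})"
  proof (rule contiguous_if_eq_on_vertices)
    show "simplicial_map (sd U) (sd K) ((`) (\<lambda>_. v))"
      using path id by (rule simplicial_map_if_contiguous_rtranclp)
    show "(\<lambda>_. v) ` \<tau> = {v}" if "\<tau> \<in> vertices (sd U)" for \<tau>
      using simplex(2)[of \<tau>] that unfolding vertices_sd by auto
  qed
  with path have "(contiguous (sd U) (sd K))\<^sup>*\<^sup>* (\<lambda>\<sigma>. \<sigma>) (\<lambda>_. {v})"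
    by simp
  then have "same_contiguity_class (sd U) (sd K) (\<lambda>\<sigma>. \<sigma>) (\<lambda>_. {v})"
    unfolding same_contiguity_class_def
    using id simplicial_map_if_contiguous_rtranclp by blast
  with vK show ?thesis
    unfolding categorical_def subcomplex_def vertices_sd
    using abstract_simplicial_complex_sd[OF U(1)] sd_mono[OF U(2)] by blast
qed

lemma abstract_simplicial_complex_face:
  assumes "abstract_simplicial_complex K" "\<sigma> \<in> K" "\<tau> \<subseteq> \<sigma>" "\<tau> \<noteq> {}"
  shows "\<tau> \<in> K"
proof -
  have "\<forall>\<tau>. \<tau> \<noteq> {} \<and> \<tau> \<subseteq> \<sigma> \<longrightarrow> \<tau> \<in> K"
    using assms(1,2) unfolding abstract_simplicial_complex_def by (elim conjE) (rule bspec)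
  with assms(3,4) show ?thesis by blast
qed

text \<open>The largest member of a chain lies in some \<open>U i\<close>, and the other members are
  faces of it. Complexes are closed under nonempty faces only, which is where the second assumption
  enters.\<close>

lemma sd_Union_subcomplexes:
  assumes "\<And>i. i \<in> I \<Longrightarrow> abstract_simplicial_complex (U i)"
    and "\<And>\<sigma>. \<sigma> \<in> (\<Union>i\<in>I. U i) \<Longrightarrow> \<sigma> \<noteq> {}"
  shows "sd (\<Union>i\<in>I. U i) = (\<Union>i\<in>I. sd (U i))"
proof
  show "(\<Union>i\<in>I. sd (U i)) \<subseteq> sd (\<Union>i\<in>I. U i)"
    using sd_mono[of _ "\<Union>i\<in>I. U i"] by blast
  show "sd (\<Union>i\<in>I. U i) \<subseteq> (\<Union>i\<in>I. sd (U i))"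
  proof
    fix C assume "C \<in> sd (\<Union>i\<in>I. U i)"
    then have C: "finite C" "C \<noteq> {}" "C \<subseteq> (\<Union>i\<in>I. U i)" "chain_subset C"
      by (simp_all add: mem_sd_iff)
    then obtain M where M: "M \<in> C" "\<And>\<sigma>. \<sigma> \<in> C \<Longrightarrow> M \<subseteq> \<sigma> \<Longrightarrow> M = \<sigma>"
      using finite_has_maximal[OF C(1,2)] by blast
    have le: "\<sigma> \<subseteq> M" if "\<sigma> \<in> C" for \<sigma>
      using that M C(4) unfolding chain_subset_def by blast
    from M(1) C(3) obtain i where i: "i \<in> I" "M \<in> U i" by blast
    have "\<sigma> \<in> U i" if "\<sigma> \<in> C" for \<sigma>
    proof (rule abstract_simplicial_complex_face[OF assms(1)[OF i(1)] i(2) le[OF that]])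
      show "\<sigma> \<noteq> {}" using subsetD[OF C(3) that] by (rule assms(2))
    qed
    then have "C \<in> sd (U i)"
      using C(1,2,4) by (simp add: mem_sd_iff subset_iff)
    with i(1) show "C \<in> (\<Union>i\<in>I. sd (U i))" by (rule UN_I)
  qed
qed

theorem theorem3p1p1:
  fixes K :: "'a set set"
  assumes "abstract_simplicial_complex K"
    and "finite K"
  shows "scat (sd K) \<le> scat K"
proof -
  \<comment> \<open>Covers are transported for every \<open>n\<close>, not just a minimal one. The
    infimum for \<open>sd K\<close> is then taken over a larger set, and no attained minimum has to
    be chosen.\<close>
  have *: "(\<exists>U. (\<forall>i\<le>n. categorical K (U i)) \<and> K = (\<Union>i\<le>n. U i)) \<longrightarrow>
      (\<exists>V. (\<forall>i\<le>n. categorical (sd K) (V i)) \<and> sd K = (\<Union>i\<le>n. V i))" for n :: nat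
  proof
    assume "\<exists>U. (\<forall>i\<le>n. categorical K (U i)) \<and> K = (\<Union>i\<le>n. U i)"
    then obtain U where U: "\<forall>i\<le>n. categorical K (U i)" "K = (\<Union>i\<le>n. U i)"
      by (elim exE conjE)
    have "categorical (sd K) (sd (U i))" if "i \<le> n" for i
    proof (rule categorical_sd)
      show "categorical K (U i)" using U(1) that by simp
      then show "finite (U i)"
        using assms(2) by (auto simp: categorical_def subcomplex_def intro: finite_subset)
    qed
    moreover have "sd (\<Union>i\<le>n. U i) = (\<Union>i\<le>n. sd (U i))"
    proof (rule sd_Union_subcomplexes)
      show "abstract_simplicial_complex (U i)" if "i \<in> {..n}" for i
        using U(1) that by (simp add: categorical_def subcomplex_def)
      show "\<sigma> \<noteq> {}" if "\<sigma> \<in> (\<Union>i\<le>n. U i)" for \<sigma>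
        using assms(1) that U(2) unfolding abstract_simplicial_complex_def by blast
    qed
    then have "sd K = (\<Union>i\<le>n. sd (U i))" by (simp only: U(2)[symmetric])
    ultimately show "\<exists>V. (\<forall>i\<le>n. categorical (sd K) (V i)) \<and> sd K = (\<Union>i\<le>n. V i)"
      by (intro exI[of _ "\<lambda>i. sd (U i)"] conjI allI impI)
  qed
  show ?thesis
    unfolding scat_def
    by (rule Inf_superset_mono, rule Collect_mono, rule ex_mono, rule conj_mono, rule imp_refl, rule *)
qed

end
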